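(* The translation into $\mathbf{RGB}$ of the supplementarity rule is provable in $\mathbf{RGB}$. That is, with $\mathcal T:\mathbf{RG}\to\mathbf{RGB}$ the translation functor, $$\mathcal T\big(g_{1,2};(r_{1,1}(1)\otimes r_{1,1}(1));g_{2,1}\big)=\mathcal T\big(g_{1,0}(2);g_{0,1}(2)\big)$$ as morphisms $*\to *$ of $\mathbf{RGB}$.
   Context: **Conventions.** All monoidal categories are strict. Composition is written in diagrammatic order: $f;g$ means first $f$, then $g$. $\mathrm{id}$ is the identity on $*$ and $\sigma:*\otimes *\to *\otimes *$ is the symmetry. Phases lie in $C_4=\mathbb Z/4\mathbb Z=\{0,1,2,3\}$. Both categories below are symmetric monoidal categories presented by generators and relations, with objects $*^n$ ($n\ge 0$, $n$-fold monoidal products of one object $*$; $*^0$ is the unit). Morphisms are open directed graphs built from the generators by composition and monoidal product, considered up to graph topology (only connectivity, and the order of the overall inputs and outputs, matters; in particular the legs of a node may be permuted freely), and modulo the listed relations. Connected components of a graph which are connected to neither an input nor an output are ignored (deleted). **Spiders.** Each colour $x$ has generators: unit $x_{0,1}:*^0\to *$, counit $x_{1,0}:*\to *^0$, multiplication $x_{2,1}:*^2\to *$, comultiplication $x_{1,2}:*\to *^2$, phase gates $x_{1,1}(\theta):*\to *$ for $\theta\in C_4$. Write $x_{m,n}(\theta):*^m\to *^n$ for the node obtained by combining $m$ inputs by multiplications (the unit if $m=0$), then applying $x_{1,1}(\theta)$, then producing $n$ outputs by comultiplications (the counit if $n=0$). Write $x_{m,n}=x_{m,n}(0)$. The *spider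 rules* for $x$ are: a node with phase $0$ equals the node with no phase; $x_{1,1}(0)=\mathrm{id}$; and two nodes of colour $x$ with phases $\alpha,\beta$ joined by $k\ge1$ wires fuse: $(x_{m,n+k}(\alpha)\otimes \mathrm{id}_{*^{m'}});(\mathrm{id}_{*^n}\otimes x_{k+m',n'}(\beta))=x_{m+m',n+n'}(\alpha+\beta)$. **Category $\mathbf{RG}$.** Generators: two colours, green $g$ and red $r$, and a gate $H:*\to *$. Relations: - the spider rules for $g$; - $(g_{1,2}\otimes g_{1,2});(\mathrm{id}\otimes\sigma\otimes\mathrm{id});(r_{2,1}\otimes r_{2,1})=r_{2,1};g_{1,2}$; - $r_{0,1};g_{1,2}=r_{0,1}\otimes r_{0,1}$; - $g_{0,2}=r_{0,2}$; - $r_{1,1}(2);g_{1,2}=g_{1,2};(r_{1,1}(2)\otimes r_{1,1}(2))$; - $g_{1,1}(2);r_{1,1}(\theta)=r_{1,1}(-\theta);g_{1,1}(2)$; - $H;H=\mathrm{id}$; - $g_{m,n}(\theta)=H^{\otimes m};r_{m,n}(\theta);H^{\otimes n}$ for all $m,n,\theta$. All equations also hold after reversing all arrows and negating all phases ($\dagger$, with $H$ unchanged), and under exchanging the colours $g$ and $r$. **Category $\mathbf{RGB}$.** Generators: three colours, red $R$, green $G$, blue $B$ (no Hadamard generator). Relations: - the spider rules for $G$; - $B_{0,1};G_{1,2}=B_{0,1}\otimes B_{0,1}$; - $R_{2,1}(3);G_{1,0}=G_{1,0}\otimes G_{1,0}$; - $(G_{1,2}\otimes G_{1,2});(\mathrm{id}\otimes\sigma\otimes\mathrm{id});(R_{2,1}(3)\otimes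 R_{2,1}(3))=R_{2,1}(3);G_{1,2}$; - $(\mathrm{id}\otimes R_{0,1});G_{2,1}=G_{1,1}(1)$; - $G_{1,1}(1);B_{1,1}(1)=R_{1,1}(1);G_{1,1}(1)=B_{1,1}(1);R_{1,1}(1)$; call this morphism $c$ and put $\bar c:=c;c$; - $\bar c^{\otimes m};B_{m,n}(\theta);c^{\otimes n}=G_{m,n}(\theta)=c^{\otimes m};R_{m,n}(\theta);\bar c^{\otimes n}$ for all $m,n,\theta$; - $(\mathrm{id}\otimes G_{0,2});(R_{2,0}\otimes\mathrm{id})=(\mathrm{id}\otimes R_{0,2});(G_{2,0}\otimes\mathrm{id})=R_{1,1}(2)$; - $(\mathrm{id}\otimes B_{0,2});(G_{2,0}\otimes\mathrm{id})=(\mathrm{id}\otimes G_{0,2});(B_{2,0}\otimes\mathrm{id})=G_{1,1}(2)$; - $(\mathrm{id}\otimes R_{0,2});(B_{2,0}\otimes\mathrm{id})=(\mathrm{id}\otimes B_{0,2});(R_{2,0}\otimes\mathrm{id})=B_{1,1}(2)$. All equations also hold after reversing all arrows and negating all phases ($\dagger$), and under even (cyclic) permutations of the three colours. **Translation $\mathcal T:\mathbf{RG}\to\mathbf{RGB}$.** It sends $*$ to $*$, respects composition and monoidal product, and on generators: $g_{1,0}\mapsto G_{1,0}$, $g_{0,1}\mapsto G_{0,1}$, $g_{1,1}(\theta)\mapsto G_{1,1}(\theta)$, $g_{1,2}\mapsto G_{1,2}$, $g_{2,1}\mapsto G_{2,1}$; $r_{1,0}\mapsto R_{1,0}(3)$,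 $r_{0,1}\mapsto R_{0,1}(1)$, $r_{1,1}(\theta)\mapsto R_{1,1}(\theta)$, $r_{1,2}\mapsto R_{1,2}(1)$, $r_{2,1}\mapsto R_{2,1}(3)$; $H\mapsto G_{1,1}(1);R_{1,1}(1);G_{1,1}(1)$. *)

theory Defs
  imports "HOL-Library.Numeral_Type"
begin

section \<open>Strict symmetric monoidal categories by generators and relations\<close>

text \<open>
  The objects are the powers of a single object and are represented by natural numbers.
  A signature gives every generator its numbers of inputs and outputs, and the generator
  that results from reversing all arrows and negating all phases.
\<close>

class signature =
  fixes src :: "'a \<Rightarrow> nat"
    and tgt :: "'a \<Rightarrow> nat"
    and flip :: "'a \<Rightarrow> 'a"

text \<open>Composition is written in diagrammatic order; \<open>Swap m n\<close> is the block symmetry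
  from \<open>m + n\<close> to \<open>n + m\<close>.\<close>

datatype 'g diag =
    Gen 'g
  | Idn nat
  | Swap nat nat
  | Seq "'g diag" "'g diag" (infixl ";;" 65)
  | Tensor "'g diag" "'g diag" (infixl "\<otimes>" 75)

primrec inputs :: "'g::signature diag \<Rightarrow> nat" where
  "inputs (Gen x) = src x"
| "inputs (Idn n) = n"
| "inputs (Swap m n) = m + n"
| "inputs (f ;; g) = inputs f"
| "inputs (f \<otimes> g) = inputs f + inputs g"

primrec outputs :: "'g::signature diag \<Rightarrow> nat" where
  "outputs (Gen x) = tgt x"
| "outputs (Idn n) = n"
| "outputs (Swap m n) = n + m"
| "outputs (f ;; g) = outputs g"
| "outputs (f \<otimes> g) = outputs f + outputs g"

primrec wf_diag :: "'g::signature diag \<Rightarrow> bool" where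
  "wf_diag (Gen x) \<longleftrightarrow> True"
| "wf_diag (Idn n) \<longleftrightarrow> True"
| "wf_diag (Swap m n) \<longleftrightarrow> True"
| "wf_diag (f ;; g) \<longleftrightarrow> wf_diag f \<and> wf_diag g \<and> outputs f = inputs g"
| "wf_diag (f \<otimes> g) \<longleftrightarrow> wf_diag f \<and> wf_diag g"

definition hom :: "nat \<Rightarrow> nat \<Rightarrow> 'g::signature diag set" where
  "hom m n = {f. wf_diag f \<and> inputs f = m \<and> outputs f = n}"

primrec tensor_power :: "'g diag \<Rightarrow> nat \<Rightarrow> 'g diag" where
  "tensor_power f 0 = Idn 0"
| "tensor_power f (Suc n) = tensor_power f n \<otimes> f"

primrec dagger :: "'g::signature diag \<Rightarrow> 'g diag" where
  "dagger (Gen x) = Gen (flip x)"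
| "dagger (Idn n) = Idn n"
| "dagger (Swap m n) = Swap n m"
| "dagger (f ;; g) = dagger g ;; dagger f"
| "dagger (f \<otimes> g) = dagger f \<otimes> dagger g"

text \<open>
  \<open>diag_eq R m n f g\<close>: the diagrams \<open>f\<close> and \<open>g\<close> are equal morphisms from \<open>m\<close> to \<open>n\<close> in the
  category presented by \<open>R\<close>. Up to \<open>scalar\<close>, this is the congruence generated by \<open>R\<close> and the
  laws of a strict symmetric monoidal category, that is, equality of open directed graphs
  modulo \<open>R\<close>. The rule \<open>scalar\<close> deletes the components that are connected to neither an input
  nor an output.
\<close>

inductive diag_eq ::
    "('g::signature diag \<Rightarrow> 'g diag \<Rightarrow> bool) \<Rightarrow> nat \<Rightarrow> nat \<Rightarrow> 'g diag \<Rightarrow> 'g diag \<Rightarrow> bool"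
  for R where
  rel: "R f g \<Longrightarrow> f \<in> hom m n \<Longrightarrow> g \<in> hom m n \<Longrightarrow> diag_eq R m n f g"
| refl: "f \<in> hom m n \<Longrightarrow> diag_eq R m n f f"
| sym: "diag_eq R m n f g \<Longrightarrow> diag_eq R m n g f"
| trans: "diag_eq R m n f g \<Longrightarrow> diag_eq R m n g h \<Longrightarrow> diag_eq R m n f h"
| seq_cong: "diag_eq R m n f f' \<Longrightarrow> diag_eq R n k g g' \<Longrightarrow> diag_eq R m k (f ;; g) (f' ;; g')"
| tensor_cong: "diag_eq R m n f f' \<Longrightarrow> diag_eq R m' n' g g'
    \<Longrightarrow> diag_eq R (m + m') (n + n') (f \<otimes> g) (f' \<otimes> g')"
| seq_assoc: "f \<in> hom m n \<Longrightarrow> g \<in> hom n k \<Longrightarrow> h \<in> hom k l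
    \<Longrightarrow> diag_eq R m l ((f ;; g) ;; h) (f ;; (g ;; h))"
| seq_id_left: "f \<in> hom m n \<Longrightarrow> diag_eq R m n (Idn m ;; f) f"
| seq_id_right: "f \<in> hom m n \<Longrightarrow> diag_eq R m n (f ;; Idn n) f"
| tensor_assoc: "f \<in> hom m n \<Longrightarrow> g \<in> hom m' n' \<Longrightarrow> h \<in> hom m'' n''
    \<Longrightarrow> diag_eq R (m + m' + m'') (n + n' + n'') ((f \<otimes> g) \<otimes> h) (f \<otimes> (g \<otimes> h))"
| tensor_unit_left: "f \<in> hom m n \<Longrightarrow> diag_eq R m n (Idn 0 \<otimes> f) f"
| tensor_unit_right: "f \<in> hom m n \<Longrightarrow> diag_eq R m n (f \<otimes> Idn 0) f"
| tensor_id: "diag_eq R (m + n) (m + n) (Idn m \<otimes> Idn n) (Idn (m + n))"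
| interchange: "f \<in> hom m n \<Longrightarrow> g \<in> hom n k \<Longrightarrow> f' \<in> hom m' n' \<Longrightarrow> g' \<in> hom n' k'
    \<Longrightarrow> diag_eq R (m + m') (k + k') ((f \<otimes> f') ;; (g \<otimes> g')) ((f ;; g) \<otimes> (f' ;; g'))"
| swap_natural: "f \<in> hom m n \<Longrightarrow> g \<in> hom m' n'
    \<Longrightarrow> diag_eq R (m + m') (n' + n) ((f \<otimes> g) ;; Swap n n') (Swap m m' ;; (g \<otimes> f))"
| swap_inverse: "diag_eq R (m + n) (m + n) (Swap m n ;; Swap n m) (Idn (m + n))"
| swap_hexagon: "diag_eq R (m + n + k) (n + k + m)
    (Swap m (n + k)) ((Swap m n \<otimes> Idn k) ;; (Idn n \<otimes> Swap m k))"
| scalar: "f \<in> hom 0 0 \<Longrightarrow> diag_eq R 0 0 f (Idn 0)"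


section \<open>Spiders\<close>

type_synonym phase = 4  \<comment> \<open>the integers modulo 4\<close>

datatype 'c node = Unit 'c | Counit 'c | Mult 'c | Comult 'c | Phase 'c phase

instantiation node :: (type) signature
begin

primrec src_node :: "'a node \<Rightarrow> nat" where
  "src_node (Unit x) = 0"
| "src_node (Counit x) = 1"
| "src_node (Mult x) = 2"
| "src_node (Comult x) = 1"
| "src_node (Phase x a) = 1"

primrec tgt_node :: "'a node \<Rightarrow> nat" where
  "tgt_node (Unit x) = 1"
| "tgt_node (Counit x) = 0"
| "tgt_node (Mult x) = 1"
| "tgt_node (Comult x) = 2"
| "tgt_node (Phase x a) = 1"

primrec flip_node :: "'a node \<Rightarrow> 'a node" where
  "flip_node (Unit x) = Counit x"
| "flip_node (Counit x) = Unit x"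
| "flip_node (Mult x) = Comult x"
| "flip_node (Comult x) = Mult x"
| "flip_node (Phase x a) = Phase x (- a)"

instance ..

end

fun merge :: "'c \<Rightarrow> nat \<Rightarrow> 'c node diag" where
  "merge x 0 = Gen (Unit x)"
| "merge x (Suc 0) = Idn 1"
| "merge x (Suc (Suc m)) = (merge x (Suc m) \<otimes> Idn 1) ;; Gen (Mult x)"

fun split :: "'c \<Rightarrow> nat \<Rightarrow> 'c node diag" where
  "split x 0 = Gen (Counit x)"
| "split x (Suc 0) = Idn 1"
| "split x (Suc (Suc n)) = Gen (Comult x) ;; (split x (Suc n) \<otimes> Idn 1)"

text \<open>By the rule \<open>phase_zero\<close> below, \<open>spider x 2 1 0\<close> is the generator \<open>Mult x\<close>, and similarly for
  the other generators; the relations are therefore written with spiders throughout.\<close>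

definition spider :: "'c \<Rightarrow> nat \<Rightarrow> nat \<Rightarrow> phase \<Rightarrow> 'c node diag" where
  "spider x m n a = merge x m ;; Gen (Phase x a) ;; split x n"

text \<open>
  The rule \<open>legs\<close> belongs to the notion of graph topology: the legs of a node have no order.
  It permutes two neighbouring inputs; outputs are treated by its dagger, under which the
  relations of both categories are closed.
\<close>

inductive spider_rel :: "'c \<Rightarrow> 'c node diag \<Rightarrow> 'c node diag \<Rightarrow> bool" for x where
  no_phase: "spider_rel x (spider x m n 0) (merge x m ;; split x n)"
| phase_zero: "spider_rel x (Gen (Phase x 0)) (Idn 1)"
| fusion: "k \<ge> 1 \<Longrightarrow> spider_rel x
    ((spider x m (n + k) a \<otimes> Idn m') ;; (Idn n \<otimes> spider x (k + m') n' b))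
    (spider x (m + m') (n + n') (a + b))"
| legs: "spider_rel x
    ((Idn i \<otimes> Swap 1 1 \<otimes> Idn j) ;; spider x (i + 2 + j) n a)
    (spider x (i + 2 + j) n a)"


section \<open>The category RG\<close>

datatype rg_colour = green | red

datatype rg_gen = Node "rg_colour node" | Had

instantiation rg_gen :: signature
begin

primrec src_rg_gen :: "rg_gen \<Rightarrow> nat" where
  "src_rg_gen (Node x) = src x"
| "src_rg_gen Had = 1"

primrec tgt_rg_gen :: "rg_gen \<Rightarrow> nat" where
  "tgt_rg_gen (Node x) = tgt x"
| "tgt_rg_gen Had = 1"

primrec flip_rg_gen :: "rg_gen \<Rightarrow> rg_gen" where
  "flip_rg_gen (Node x) = Node (flip x)"
| "flip_rg_gen Had = Had"

instance ..

end

primrec swap_colour :: "rg_colour \<Rightarrow> rg_colour" where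
  "swap_colour green = red"
| "swap_colour red = green"

primrec swap_gen :: "rg_gen \<Rightarrow> rg_gen" where
  "swap_gen (Node x) = Node (map_node swap_colour x)"
| "swap_gen Had = Had"

abbreviation rg_spider :: "rg_colour \<Rightarrow> nat \<Rightarrow> nat \<Rightarrow> phase \<Rightarrow> rg_gen diag" where
  "rg_spider x m n a \<equiv> map_diag Node (spider x m n a)"

inductive rg_rel :: "rg_gen diag \<Rightarrow> rg_gen diag \<Rightarrow> bool" where
  spider: "spider_rel green f g \<Longrightarrow> rg_rel (map_diag Node f) (map_diag Node g)"
| bialgebra: "rg_rel
    ((rg_spider green 1 2 0 \<otimes> rg_spider green 1 2 0) ;; (Idn 1 \<otimes> Swap 1 1 \<otimes> Idn 1)
      ;; (rg_spider red 2 1 0 \<otimes> rg_spider red 2 1 0))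
    (rg_spider red 2 1 0 ;; rg_spider green 1 2 0)"
| copy: "rg_rel
    (rg_spider red 0 1 0 ;; rg_spider green 1 2 0)
    (rg_spider red 0 1 0 \<otimes> rg_spider red 0 1 0)"
| cups: "rg_rel (rg_spider green 0 2 0) (rg_spider red 0 2 0)"
| pi_copy: "rg_rel
    (rg_spider red 1 1 2 ;; rg_spider green 1 2 0)
    (rg_spider green 1 2 0 ;; (rg_spider red 1 1 2 \<otimes> rg_spider red 1 1 2))"
| pi_commute: "rg_rel
    (rg_spider green 1 1 2 ;; rg_spider red 1 1 a)
    (rg_spider red 1 1 (- a) ;; rg_spider green 1 1 2)"
| had_involution: "rg_rel (Gen Had ;; Gen Had) (Idn 1)"
| had_colour: "rg_rel
    (rg_spider green m n a)
    (tensor_power (Gen Had) m ;; rg_spider red m n a ;; tensor_power (Gen Had) n)"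
| dagger: "rg_rel f g \<Longrightarrow> rg_rel (dagger f) (dagger g)"
| colours: "rg_rel f g \<Longrightarrow> rg_rel (map_diag swap_gen f) (map_diag swap_gen g)"

abbreviation rg_eq :: "nat \<Rightarrow> nat \<Rightarrow> rg_gen diag \<Rightarrow> rg_gen diag \<Rightarrow> bool" where
  "rg_eq \<equiv> diag_eq rg_rel"


section \<open>The category RGB\<close>

datatype rgb_colour = Red | Green | Blue

type_synonym rgb_gen = "rgb_colour node"

primrec rotate_colour :: "rgb_colour \<Rightarrow> rgb_colour" where
  "rotate_colour Red = Green"
| "rotate_colour Green = Blue"
| "rotate_colour Blue = Red"

text \<open>\<open>cgate\<close> is the first of the three diagrams for \<open>c\<close>; the rules \<open>cgate1\<close> and \<open>cgate2\<close>
  identify it with the other two.\<close>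

definition cgate :: "rgb_gen diag" where
  "cgate = spider Green 1 1 1 ;; spider Blue 1 1 1"

definition cbar :: "rgb_gen diag" where
  "cbar = cgate ;; cgate"

inductive rgb_rel :: "rgb_gen diag \<Rightarrow> rgb_gen diag \<Rightarrow> bool" where
  spider: "spider_rel Green f g \<Longrightarrow> rgb_rel f g"
| copy: "rgb_rel
    (spider Blue 0 1 0 ;; spider Green 1 2 0)
    (spider Blue 0 1 0 \<otimes> spider Blue 0 1 0)"
| cocopy: "rgb_rel
    (spider Red 2 1 3 ;; spider Green 1 0 0)
    (spider Green 1 0 0 \<otimes> spider Green 1 0 0)"
| bialgebra: "rgb_rel
    ((spider Green 1 2 0 \<otimes> spider Green 1 2 0) ;; (Idn 1 \<otimes> Swap 1 1 \<otimes> Idn 1)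
      ;; (spider Red 2 1 3 \<otimes> spider Red 2 1 3))
    (spider Red 2 1 3 ;; spider Green 1 2 0)"
| point: "rgb_rel
    ((Idn 1 \<otimes> spider Red 0 1 0) ;; spider Green 2 1 0)
    (spider Green 1 1 1)"
| cgate1: "rgb_rel cgate (spider Red 1 1 1 ;; spider Green 1 1 1)"
| cgate2: "rgb_rel cgate (spider Blue 1 1 1 ;; spider Red 1 1 1)"
| colour_blue: "rgb_rel
    (tensor_power cbar m ;; spider Blue m n a ;; tensor_power cgate n)
    (spider Green m n a)"
| colour_red: "rgb_rel
    (spider Green m n a)
    (tensor_power cgate m ;; spider Red m n a ;; tensor_power cbar n)"
| zigzag_GR: "rgb_rel
    ((Idn 1 \<otimes> spider Green 0 2 0) ;; (spider Red 2 0 0 \<otimes> Idn 1)) (spider Red 1 1 2)"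
| zigzag_RG: "rgb_rel
    ((Idn 1 \<otimes> spider Red 0 2 0) ;; (spider Green 2 0 0 \<otimes> Idn 1)) (spider Red 1 1 2)"
| zigzag_BG: "rgb_rel
    ((Idn 1 \<otimes> spider Blue 0 2 0) ;; (spider Green 2 0 0 \<otimes> Idn 1)) (spider Green 1 1 2)"
| zigzag_GB: "rgb_rel
    ((Idn 1 \<otimes> spider Green 0 2 0) ;; (spider Blue 2 0 0 \<otimes> Idn 1)) (spider Green 1 1 2)"
| zigzag_RB: "rgb_rel
    ((Idn 1 \<otimes> spider Red 0 2 0) ;; (spider Blue 2 0 0 \<otimes> Idn 1)) (spider Blue 1 1 2)"
| zigzag_BR: "rgb_rel
    ((Idn 1 \<otimes> spider Blue 0 2 0) ;; (spider Red 2 0 0 \<otimes> Idn 1)) (spider Blue 1 1 2)"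
| dagger: "rgb_rel f g \<Longrightarrow> rgb_rel (dagger f) (dagger g)"
| colours: "rgb_rel f g
    \<Longrightarrow> rgb_rel (map_diag (map_node rotate_colour) f) (map_diag (map_node rotate_colour) g)"

abbreviation rgb_eq :: "nat \<Rightarrow> nat \<Rightarrow> rgb_gen diag \<Rightarrow> rgb_gen diag \<Rightarrow> bool" where
  "rgb_eq \<equiv> diag_eq rgb_rel"


section \<open>The translation\<close>

fun translate_node :: "rg_colour node \<Rightarrow> rgb_gen diag" where
  "translate_node (Counit green) = Gen (Counit Green)"
| "translate_node (Unit green) = Gen (Unit Green)"
| "translate_node (Phase green a) = Gen (Phase Green a)"
| "translate_node (Comult green) = Gen (Comult Green)"
| "translate_node (Mult green) = Gen (Mult Green)"
| "translate_node (Counit red) = spider Red 1 0 3"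
| "translate_node (Unit red) = spider Red 0 1 1"
| "translate_node (Phase red a) = Gen (Phase Red a)"
| "translate_node (Comult red) = spider Red 1 2 1"
| "translate_node (Mult red) = spider Red 2 1 3"

primrec translate_gen :: "rg_gen \<Rightarrow> rgb_gen diag" where
  "translate_gen (Node x) = translate_node x"
| "translate_gen Had = spider Green 1 1 1 ;; spider Red 1 1 1 ;; spider Green 1 1 1"

text \<open>The translation is defined on the diagrams that represent morphisms of RG, so its
  definition does not presuppose that the relations of RG are sound in RGB.\<close>

primrec translate :: "rg_gen diag \<Rightarrow> rgb_gen diag" where
  "translate (Gen x) = translate_gen x"
| "translate (Idn n) = Idn n"
| "translate (Swap m n) = Swap m n"
| "translate (f ;; g) = translate f ;; translate g"
| "translate (f \<otimes> g) = translate f \<otimes> translate g"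

end

theory Submission
  imports Defs
begin

text \<open>
  Write \<open>c = R(1);G(1) = G(1);B(1)\<close> for the gate that permutes the colours cyclically. The red
  quarter turn is \<open>R(1) = c;G(-1)\<close>, and the two green gates \<open>G(-1)\<close> can be pushed through the
  green multiplication. What is left between the green comultiplication and the green
  multiplication is a pair of gates \<open>c\<close>, and colour change turns \<open>(c \<otimes> c);G\<^bsub>2,1\<^esub>\<close> into
  \<open>B\<^bsub>2,1\<^esub>;c\<close>. So a green comultiplication meets a blue multiplication along two wires. These two
  form a Hopf algebra with trivial antipode, up to a phase, so the pair of wires can be cut
  (lemma \<open>green_blue_hopf\<close>), and the left-hand side falls apart into a green counit and a
  unit. Collecting the phases gives \<open>G\<^bsub>1,0\<^esub>(2);G\<^bsub>0,1\<^esub>(2)\<close>.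

  The Hopf law follows from the bialgebra law by plugging a copyable unit into one input and a
  counit into one output. In the four-node square of the bialgebra law this leaves a cup and a
  cap. By the zigzag relations green and blue cups and caps agree up to the phase \<open>2\<close>, so
  the cup and the cap straighten to a wire, and only the green and the blue node with their two
  connecting wires remain. On the other side of the law the
  plugged unit is absorbed by the blue multiplication, which disconnects the diagram.
\<close>

section \<open>Morphisms of RGB as a quotient type\<close>

text \<open>
  Working with genuine equations between morphisms makes the axioms of a strict monoidal category
  available to the simplifier. The relation is total: ill-formed diagrams
  with the same numbers of inputs and outputs form one class. An ill-formed part makes the
  whole diagram ill-formed, so associativity holds as an unconditional
  equation, and the unit and interchange laws ask only for matching arities.
\<close>

definition same_morphism :: "rgb_gen diag \<Rightarrow> rgb_gen diag \<Rightarrow> bool" where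
  "same_morphism f g \<longleftrightarrow> inputs f = inputs g \<and> outputs f = outputs g \<and> wf_diag f = wf_diag g
    \<and> (wf_diag f \<longrightarrow> rgb_eq (inputs f) (outputs f) f g)"

(* Arities are explicit numerals throughout, and rewriting 1 to Suc 0 would hide them. *)
declare One_nat_def [simp del]

lemma diag_eq_hom:
  "diag_eq R m n f g \<Longrightarrow> f \<in> hom m n \<and> g \<in> hom m n"
  by (induction rule: diag_eq.induct) (auto simp: hom_def)

lemma diag_eq_imp_same_morphism: "rgb_eq m n f g \<Longrightarrow> same_morphism f g"
  using diag_eq_hom[of rgb_rel m n f g] by (auto simp: same_morphism_def hom_def)

lemma same_morphism_imp_diag_eq: "same_morphism f g \<Longrightarrow> f \<in> hom m n \<Longrightarrow> rgb_eq m n f g"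
  by (auto simp: same_morphism_def hom_def)

quotient_type mor = "rgb_gen diag" / same_morphism
proof (rule equivpI)
  show "reflp same_morphism"
    by (auto simp: reflp_def same_morphism_def hom_def intro!: diag_eq.refl)
  show "symp same_morphism"
    by (auto simp: symp_def same_morphism_def intro: diag_eq.sym)
  show "transp same_morphism"
    unfolding transp_def same_morphism_def using diag_eq.trans by metis
qed

lift_definition dom :: "mor \<Rightarrow> nat" is inputs by (simp add: same_morphism_def)
lift_definition cod :: "mor \<Rightarrow> nat" is outputs by (simp add: same_morphism_def)
lift_definition idn :: "nat \<Rightarrow> mor" is Idn .
lift_definition swap :: "nat \<Rightarrow> nat \<Rightarrow> mor" is Swap .

lift_definition seq :: "mor \<Rightarrow> mor \<Rightarrow> mor" (infixl "\<cdot>" 65) is Seq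
  by (auto simp: same_morphism_def intro: diag_eq.seq_cong)

lift_definition tens :: "mor \<Rightarrow> mor \<Rightarrow> mor" (infixl "\<boxtimes>" 75) is Tensor
  by (auto simp: same_morphism_def intro: diag_eq.tensor_cong)

lemma dom_cod [simp]:
  "dom (idn n) = n" "cod (idn n) = n"
  "dom (swap m n) = m + n" "cod (swap m n) = n + m"
  "dom (f \<cdot> g) = dom f" "cod (f \<cdot> g) = cod g"
  "dom (f \<boxtimes> g) = dom f + dom g" "cod (f \<boxtimes> g) = cod f + cod g"
  by (transfer; simp add: same_morphism_def)+

lemma seq_assoc: "(f \<cdot> g) \<cdot> h = f \<cdot> (g \<cdot> h)"
  by transfer (auto simp: same_morphism_def hom_def intro!: diag_eq.seq_assoc)

lemma tens_assoc: "(f \<boxtimes> g) \<boxtimes> h = f \<boxtimes> (g \<boxtimes> h)"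
proof transfer
  fix f g h :: "rgb_gen diag"
  have "rgb_eq (inputs f + inputs g + inputs h) (outputs f + outputs g + outputs h)
      (f \<otimes> g \<otimes> h) (f \<otimes> (g \<otimes> h))" if "wf_diag f" "wf_diag g" "wf_diag h"
    by (rule diag_eq.tensor_assoc) (use that in \<open>auto simp: hom_def\<close>)
  then show "same_morphism (f \<otimes> g \<otimes> h) (f \<otimes> (g \<otimes> h))"
    by (auto simp: same_morphism_def)
qed

lemma idn_seq [simp]: "dom f = m \<Longrightarrow> idn m \<cdot> f = f"
  by transfer (auto simp: same_morphism_def hom_def intro!: diag_eq.seq_id_left)

lemma seq_idn [simp]: "cod f = n \<Longrightarrow> f \<cdot> idn n = f"
  by transfer (auto simp: same_morphism_def hom_def intro!: diag_eq.seq_id_right)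

lemma idn0_tens [simp]: "idn 0 \<boxtimes> f = f"
  by transfer (auto simp: same_morphism_def hom_def intro!: diag_eq.tensor_unit_left)

lemma tens_idn0 [simp]: "f \<boxtimes> idn 0 = f"
  by transfer (auto simp: same_morphism_def hom_def intro!: diag_eq.tensor_unit_right)

lemma idn_tens_idn [simp]: "idn m \<boxtimes> idn n = idn (m + n)"
  by transfer (auto simp: same_morphism_def intro!: diag_eq.tensor_id)

lemma interchange:
  "cod f = dom g \<Longrightarrow> cod f' = dom g' \<Longrightarrow> (f \<boxtimes> f') \<cdot> (g \<boxtimes> g') = (f \<cdot> g) \<boxtimes> (f' \<cdot> g')"
  by transfer (auto simp: same_morphism_def hom_def intro!: diag_eq.interchange)

lemma swap_natural: "(f \<boxtimes> g) \<cdot> swap (cod f) (cod g) = swap (dom f) (dom g) \<cdot> (g \<boxtimes> f)"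
  by transfer (auto simp: same_morphism_def hom_def intro!: diag_eq.swap_natural)

lemma swap_swap: "swap m n \<cdot> swap n m = idn (m + n)"
  by transfer (auto simp: same_morphism_def intro!: diag_eq.swap_inverse)

lemma swap_hexagon: "swap m (n + k) = (swap m n \<boxtimes> idn k) \<cdot> (idn n \<boxtimes> swap m k)"
proof transfer
  fix m n k
  show "same_morphism (Swap m (n + k)) (Swap m n \<otimes> Idn k ;; Idn n \<otimes> Swap m k)"
    by (rule diag_eq_imp_same_morphism) (rule diag_eq.swap_hexagon)
qed

text \<open>The hexagon makes this swap idempotent, and it is invertible.\<close>

lemma swap_0 [simp]: "swap m 0 = idn m"
proof -
  have "swap m 0 \<cdot> swap m 0 = swap m 0"
    using swap_hexagon[of m 0 0] by simp
  then have "swap m 0 \<cdot> (swap m 0 \<cdot> swap 0 m) = swap m 0 \<cdot> swap 0 m"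
    by (metis seq_assoc)
  then show ?thesis
    by (simp add: swap_swap)
qed

lemma tens_top_left: "dom g = m \<Longrightarrow> cod f = n \<Longrightarrow> (f \<boxtimes> idn m) \<cdot> (idn n \<boxtimes> g) = f \<boxtimes> g"
  by (simp add: interchange)

lemma tens_top_right: "dom f = m \<Longrightarrow> cod g = n \<Longrightarrow> (idn m \<boxtimes> g) \<cdot> (f \<boxtimes> idn n) = f \<boxtimes> g"
  by (simp add: interchange)


section \<open>Spiders\<close>

lemma one_leg [simp]:
  "merge x 1 = Idn 1" "split x 1 = Idn 1" "tensor_power f 1 = Idn 0 \<otimes> f"
  by (simp_all add: One_nat_def)

lemma merge_typed [simp]:
  "inputs (merge x m) = m" "outputs (merge x m) = 1" "wf_diag (merge x m)"
  by (induction x m rule: merge.induct) auto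

lemma split_typed [simp]:
  "inputs (split x n) = 1" "outputs (split x n) = n" "wf_diag (split x n)"
  by (induction x n rule: split.induct) auto

lemma spider_typed [simp]:
  "inputs (spider x m n a) = m" "outputs (spider x m n a) = n" "wf_diag (spider x m n a)"
  by (auto simp: spider_def)

lemma rotate_merge [simp]:
  "map_diag (map_node rotate_colour) (merge x m) = merge (rotate_colour x) m"
  by (induction x m rule: merge.induct) auto

lemma rotate_split [simp]:
  "map_diag (map_node rotate_colour) (split x m) = split (rotate_colour x) m"
  by (induction x m rule: split.induct) auto

lemma rotate_spider [simp]:
  "map_diag (map_node rotate_colour) (spider x m n a) = spider (rotate_colour x) m n a"
  by (simp add: spider_def)

lemma dagger_merge [simp]: "dagger (merge x m) = split x m"
  by (induction x m rule: merge.induct) auto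

lemma dagger_split [simp]: "dagger (split x m) = merge x m"
  by (induction x m rule: split.induct) auto

text \<open>For signatures in general, reversal need not exchange sources and targets; it does
  for nodes.\<close>

lemma dagger_typed [simp]:
  fixes f :: "rgb_gen diag"
  shows "inputs (dagger f) = outputs f" "outputs (dagger f) = inputs f"
    and "wf_diag (dagger f) = wf_diag f"
proof -
  have gen: "src (flip x) = tgt x" "tgt (flip x) = src x" for x :: rgb_gen
    by (cases x; simp)+
  have io: "inputs (dagger f) = outputs f \<and> outputs (dagger f) = inputs f" for f :: "rgb_gen diag"
    by (induction f) (auto simp: gen)
  then show "inputs (dagger f) = outputs f" "outputs (dagger f) = inputs f"
    by blast+
  show "wf_diag (dagger f) = wf_diag f"
    by (induction f) (auto simp: io)
qed

text \<open>The presentation postulates the spider rules for green only; the cyclic permutations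
  carry them to blue and then to red.\<close>

lemma rgb_rel_spider_step:
  assumes "spider_rel (rotate_colour x) f g"
    and "\<And>f g. spider_rel x f g \<Longrightarrow> rgb_rel f g"
  shows "rgb_rel f g"
  using assms(1)
proof cases
  case (no_phase m n)
  then show ?thesis
    using rgb_rel.colours[OF assms(2)[OF spider_rel.no_phase[of x m n]]] by simp
next
  case phase_zero
  then show ?thesis
    using rgb_rel.colours[OF assms(2)[OF spider_rel.phase_zero[of x]]] by simp
next
  case (fusion k m n a m' n' b)
  then show ?thesis
    using rgb_rel.colours[OF assms(2)[OF spider_rel.fusion[of k x m n a m' n' b]]] by simp
next
  case (legs i j n a)
  then show ?thesis
    using rgb_rel.colours[OF assms(2)[OF spider_rel.legs[of x i j n a]]] by simp
qed

lemma rgb_rel_spider: "spider_rel x f g \<Longrightarrow> rgb_rel f g"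
proof -
  have blue: "rgb_rel f g" if "spider_rel Blue f g" for f g
    using rgb_rel_spider_step[of Green f g] that rgb_rel.spider by simp
  have "rgb_rel f g" if "spider_rel Red f g" for f g
    using rgb_rel_spider_step[of Blue f g] that blue by simp
  with blue rgb_rel.spider show "spider_rel x f g \<Longrightarrow> rgb_rel f g"
    by (cases x) auto
qed

lift_definition S :: "rgb_colour \<Rightarrow> nat \<Rightarrow> nat \<Rightarrow> phase \<Rightarrow> mor" is spider .

lemma S_typed [simp]: "dom (S x m n a) = m" "cod (S x m n a) = n"
  by (transfer, simp)+

lemmas abs_mor_simps = seq.abs_eq[symmetric] tens.abs_eq[symmetric] idn.abs_eq[symmetric]
  swap.abs_eq[symmetric] S.abs_eq[symmetric]

lemma abs_mor_eqI: "rgb_eq m n f g \<Longrightarrow> abs_mor f = abs_mor g"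
  using diag_eq_imp_same_morphism mor.abs_eq_iff by blast

lemma rgb_rel_imp_eq:
  assumes "rgb_rel f g" "wf_diag f" "wf_diag g" "inputs f = inputs g" "outputs f = outputs g"
  shows "abs_mor f = abs_mor g"
  by (rule abs_mor_eqI, rule diag_eq.rel[where R = rgb_rel and m = "inputs g" and n = "outputs g"])
    (simp_all add: hom_def assms)

lemma dagger_spider: "abs_mor (dagger (spider x m n a)) = S x n m (- a)"
  unfolding spider_def S.abs_eq
  by (simp add: abs_mor_simps(1) seq_assoc)

lemma fusion:
  assumes "k \<ge> 1"
  shows "(S x m (n + k) a \<boxtimes> idn m') \<cdot> (idn n \<boxtimes> S x (k + m') n' b)
     = S x (m + m') (n + n') (a + b)"
  using rgb_rel_imp_eq[OF rgb_rel_spider[OF spider_rel.fusion[OF assms, of x m n a m' n' b]]]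
  by (simp add: abs_mor_simps add_ac)

text \<open>The mirror image of \<open>fusion\<close>, with the connecting wires running the other way; it is the
  dagger of \<open>fusion\<close> with negated phases.\<close>

lemma cofusion:
  assumes "k \<ge> 1"
  shows "(idn n \<boxtimes> S x n' (k + m') b) \<cdot> (S x (n + k) m a \<boxtimes> idn m')
     = S x (n + n') (m + m') (a + b)"
  using rgb_rel_imp_eq[OF rgb_rel.dagger[OF rgb_rel_spider[OF
      spider_rel.fusion[OF assms, of x m n "- a" m' n' "- b"]]]]
  by (simp add: abs_mor_simps dagger_spider add_ac)

lemma leg_swap: "swap 1 1 \<cdot> S x 2 n a = S x 2 n a"
  using rgb_rel_imp_eq[OF rgb_rel_spider[OF spider_rel.legs[of x 0 0 n a]]]
  by (simp add: abs_mor_simps numeral_2_eq_2)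

lemma S_1_1_0 [simp]: "S x 1 1 0 = idn 1"
  using rgb_rel_imp_eq[OF rgb_rel_spider[OF spider_rel.no_phase[of x 1 1]]]
  by (simp add: abs_mor_simps)


section \<open>The Hopf law for green and blue\<close>

lemma phase_arith: "(4 :: phase) = 0" "(6 :: phase) = 2" "(- 3 :: phase) = 1"
proof -
  show four: "(4 :: phase) = 0"
    by (simp add: bit0.Rep_inject_sym bit0.Rep_numeral bit0.Rep_0)
  have "(6 :: phase) = 4 + 2" "(- 3 :: phase) = 1 - 4"
    by simp_all
  then show "(6 :: phase) = 2" "(- 3 :: phase) = 1"
    by (simp_all only: four add_0 diff_0_right)
qed

lemma snake: "(S x 0 2 0 \<boxtimes> idn 1) \<cdot> (idn 1 \<boxtimes> S x 2 0 0) = idn 1"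
  using fusion[of 1 x 0 1 0 1 0 0] by simp

text \<open>Since the legs of a cap may be exchanged, the single crossing can be completed to the
  block symmetry past a cup, over which the wire slides freely; a snake remains.\<close>

lemma twisted_snake:
  "(idn 1 \<boxtimes> S x 0 2 0) \<cdot> ((swap 1 1 \<boxtimes> idn 1) \<cdot> (idn 1 \<boxtimes> S x 2 0 0)) = idn 1"
proof -
  have "(idn 1 \<boxtimes> S x 0 2 0) \<cdot> ((swap 1 1 \<boxtimes> idn 1) \<cdot> (idn 1 \<boxtimes> S x 2 0 0))
      = (idn 1 \<boxtimes> S x 0 2 0) \<cdot> ((swap 1 1 \<boxtimes> idn 1) \<cdot> (idn 1 \<boxtimes> (swap 1 1 \<cdot> S x 2 0 0)))"
    by (simp add: leg_swap)
  also have "idn 1 \<boxtimes> (swap 1 1 \<cdot> S x 2 0 0) = (idn 1 \<boxtimes> swap 1 1) \<cdot> (idn 1 \<boxtimes> S x 2 0 0)"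
    by (simp add: interchange)
  also have "(idn 1 \<boxtimes> S x 0 2 0) \<cdot> ((swap 1 1 \<boxtimes> idn 1) \<cdot> \<dots>)
      = ((idn 1 \<boxtimes> S x 0 2 0) \<cdot> ((swap 1 1 \<boxtimes> idn 1) \<cdot> (idn 1 \<boxtimes> swap 1 1)))
        \<cdot> (idn 1 \<boxtimes> S x 2 0 0)"
    by (simp only: seq_assoc)
  also have "(swap 1 1 \<boxtimes> idn 1) \<cdot> (idn 1 \<boxtimes> swap 1 1) = swap 1 2"
    using swap_hexagon[of 1 1 1] by simp
  also have "(idn 1 \<boxtimes> S x 0 2 0) \<cdot> swap 1 2 = S x 0 2 0 \<boxtimes> idn 1"
    using swap_natural[of "idn 1" "S x 0 2 0"] by simp
  finally show ?thesis
    by (simp add: snake)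
qed

text \<open>The zigzag of a green cup against a blue cap is \<open>G(2)\<close>. Bending one of its ends with a
  green cap cancels the green cup, so only the blue cap survives.\<close>

lemma blue_cap: "S Blue 2 0 0 = S Green 2 0 2"
proof -
  let ?g = "S Green" and ?b = "S Blue" and ?I = "idn 1"
  have zigzag: "(?I \<boxtimes> ?g 0 2 0) \<cdot> (?b 2 0 0 \<boxtimes> ?I) = ?g 1 1 2"
    using rgb_rel_imp_eq[OF rgb_rel.zigzag_GB] by (simp add: abs_mor_simps)
  have "?g 2 0 2 = (?g 1 1 2 \<boxtimes> ?I) \<cdot> ?g 2 0 0"
    using fusion[of 1 Green 1 0 2 1 0 0] by simp
  also have "?g 1 1 2 \<boxtimes> ?I = ((?I \<boxtimes> ?g 0 2 0) \<boxtimes> ?I) \<cdot> ((?b 2 0 0 \<boxtimes> ?I) \<boxtimes> ?I)"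
    by (simp add: interchange zigzag)
  also have "\<dots> \<cdot> ?g 2 0 0 = ((?I \<boxtimes> ?g 0 2 0) \<boxtimes> ?I) \<cdot> ((?b 2 0 0 \<boxtimes> idn 2) \<cdot> ?g 2 0 0)"
    by (simp add: seq_assoc tens_assoc)
  also have "(?b 2 0 0 \<boxtimes> idn 2) \<cdot> ?g 2 0 0 = ?b 2 0 0 \<boxtimes> ?g 2 0 0"
    using tens_top_left[of "?g 2 0 0" 2 "?b 2 0 0" 0] by simp
  also have "\<dots> = (idn 2 \<boxtimes> ?g 2 0 0) \<cdot> ?b 2 0 0"
    using tens_top_right[of "?b 2 0 0" 2 "?g 2 0 0" 0] by simp
  also have "idn 2 \<boxtimes> ?g 2 0 0 = ?I \<boxtimes> (?I \<boxtimes> ?g 2 0 0)"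
    by (simp flip: tens_assoc)
  also have "((?I \<boxtimes> ?g 0 2 0) \<boxtimes> ?I) \<cdot> (\<dots> \<cdot> ?b 2 0 0)
      = (?I \<boxtimes> ((?g 0 2 0 \<boxtimes> ?I) \<cdot> (?I \<boxtimes> ?g 2 0 0))) \<cdot> ?b 2 0 0"
    by (simp add: tens_assoc interchange flip: seq_assoc)
  finally show ?thesis
    by (simp add: snake)
qed

text \<open>The mirror image of the argument for \<open>blue_cap\<close>, with the zigzag of a blue cup against a
  green cap.\<close>

lemma blue_cup: "S Blue 0 2 0 = S Green 0 2 2"
proof -
  let ?g = "S Green" and ?b = "S Blue" and ?I = "idn 1"
  have zigzag: "(?I \<boxtimes> ?b 0 2 0) \<cdot> (?g 2 0 0 \<boxtimes> ?I) = ?g 1 1 2"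
    using rgb_rel_imp_eq[OF rgb_rel.zigzag_BG] by (simp add: abs_mor_simps)
  have "?g 0 2 2 = ?g 0 2 0 \<cdot> (?I \<boxtimes> ?g 1 1 2)"
    using fusion[of 1 Green 0 1 0 0 1 2] by simp
  also have "?I \<boxtimes> ?g 1 1 2 = (?I \<boxtimes> (?I \<boxtimes> ?b 0 2 0)) \<cdot> (?I \<boxtimes> (?g 2 0 0 \<boxtimes> ?I))"
    by (simp add: interchange zigzag)
  also have "?g 0 2 0 \<cdot> \<dots> = (?g 0 2 0 \<cdot> (idn 2 \<boxtimes> ?b 0 2 0)) \<cdot> ((?I \<boxtimes> ?g 2 0 0) \<boxtimes> ?I)"
    by (simp add: seq_assoc flip: tens_assoc)
  also have "?g 0 2 0 \<cdot> (idn 2 \<boxtimes> ?b 0 2 0) = ?g 0 2 0 \<boxtimes> ?b 0 2 0"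
    using tens_top_left[of "?b 0 2 0" 0 "?g 0 2 0" 2] by simp
  also have "\<dots> = ?b 0 2 0 \<cdot> (?g 0 2 0 \<boxtimes> idn 2)"
    using tens_top_right[of "?g 0 2 0" 0 "?b 0 2 0" 2] by simp
  also have "?g 0 2 0 \<boxtimes> idn 2 = (?g 0 2 0 \<boxtimes> ?I) \<boxtimes> ?I"
    by (simp add: tens_assoc)
  also have "?b 0 2 0 \<cdot> \<dots> \<cdot> ((?I \<boxtimes> ?g 2 0 0) \<boxtimes> ?I)
      = ?b 0 2 0 \<cdot> (((?g 0 2 0 \<boxtimes> ?I) \<cdot> (?I \<boxtimes> ?g 2 0 0)) \<boxtimes> ?I)"
    by (simp add: seq_assoc interchange)
  finally show ?thesis
    by (simp add: snake)
qed

text \<open>Plugging the red unit into a green multiplication is \<open>G(1)\<close>; plugging the green unit into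
  the other input recovers the red unit itself.\<close>

lemma red_unit: "S Red 0 1 0 = S Green 0 1 1"
proof -
  let ?g = "S Green" and ?r = "S Red 0 1 0" and ?I = "idn 1"
  have point: "(?I \<boxtimes> ?r) \<cdot> ?g 2 1 0 = ?g 1 1 1"
    using rgb_rel_imp_eq[OF rgb_rel.point] by (simp add: abs_mor_simps)
  have "?g 0 1 1 = ?g 0 1 0 \<cdot> ?g 1 1 1"
    using fusion[of 1 Green 0 0 0 0 1 1] by simp
  also have "\<dots> = (?g 0 1 0 \<cdot> (?I \<boxtimes> ?r)) \<cdot> ?g 2 1 0"
    by (simp only: point seq_assoc)
  also have "?g 0 1 0 \<cdot> (?I \<boxtimes> ?r) = ?r \<cdot> (?g 0 1 0 \<boxtimes> ?I)"
    using tens_top_left[of ?r 0 "?g 0 1 0" 1] tens_top_right[of "?g 0 1 0" 0 ?r 1] by simp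
  also have "\<dots> \<cdot> ?g 2 1 0 = ?r \<cdot> ((?g 0 1 0 \<boxtimes> ?I) \<cdot> ?g 2 1 0)"
    by (rule seq_assoc)
  also have "(?g 0 1 0 \<boxtimes> ?I) \<cdot> ?g 2 1 0 = ?I"
    using fusion[of 1 Green 0 0 0 1 1 0] by simp
  finally show ?thesis
    by simp
qed

lemma red_unit_blue_copy: "S Red 0 1 0 \<cdot> S Blue 1 2 0 = S Red 0 1 0 \<boxtimes> S Red 0 1 0"
  using rgb_rel_imp_eq[OF rgb_rel.colours[OF rgb_rel.copy]] by (simp add: abs_mor_simps)

text \<open>Reversing all arrows exchanges the roles of multiplication and comultiplication, so the
  green-red law, rotated to blue-green and reversed, has an undecorated blue multiplication;
  its green comultiplication carries the phase \<open>-3 = 1\<close>.\<close>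

lemma blue_green_bialgebra:
  "(S Green 1 2 1 \<boxtimes> S Green 1 2 1) \<cdot> ((idn 1 \<boxtimes> swap 1 1 \<boxtimes> idn 1) \<cdot> (S Blue 2 1 0 \<boxtimes> S Blue 2 1 0))
    = S Blue 2 1 0 \<cdot> S Green 1 2 1"
  using rgb_rel_imp_eq[OF rgb_rel.dagger[OF rgb_rel.colours[OF rgb_rel.bialgebra]]]
  by (simp add: abs_mor_simps dagger_spider phase_arith)

text \<open>The blue multiplication is a blue comultiplication with one leg bent down by a cap. The
  red unit is copied by blue: one copy is the output, the other meets the cap, where it becomes
  a green counit because the red unit and the blue cap are both green up to phase.\<close>

lemma red_unit_blue_mult: "(idn 1 \<boxtimes> S Red 0 1 0) \<cdot> S Blue 2 1 0 = S Green 1 0 3 \<cdot> S Red 0 1 0"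
proof -
  let ?b = "S Blue" and ?r = "S Red 0 1 0" and ?I = "idn 1"
  have "?b 2 1 0 = (?I \<boxtimes> ?b 1 2 0) \<cdot> (?b 2 0 0 \<boxtimes> ?I)"
    using cofusion[of 1 1 Blue 1 1 0 0 0] by simp
  also have "(?I \<boxtimes> ?r) \<cdot> \<dots> = (?I \<boxtimes> (?r \<cdot> ?b 1 2 0)) \<cdot> (?b 2 0 0 \<boxtimes> ?I)"
    by (simp add: interchange flip: seq_assoc)
  also have "\<dots> = ((?I \<boxtimes> ?r) \<boxtimes> ?r) \<cdot> (?b 2 0 0 \<boxtimes> ?I)"
    by (simp only: red_unit_blue_copy tens_assoc)
  also have "\<dots> = ((?I \<boxtimes> ?r) \<cdot> ?b 2 0 0) \<boxtimes> ?r"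
    by (simp add: interchange)
  also have "(?I \<boxtimes> ?r) \<cdot> ?b 2 0 0 = S Green 1 0 3"
    using cofusion[of 1 1 Green 0 0 1 0 2] by (simp add: red_unit blue_cap)
  also have "S Green 1 0 3 \<boxtimes> ?r = S Green 1 0 3 \<cdot> ?r"
    using tens_top_left[of ?r 0 "S Green 1 0 3" 0] by simp
  finally show ?thesis .
qed

text \<open>Both sides arise from the bialgebra law when the red unit is plugged into the second input
  and the blue counit into the second output. On the side with four nodes, the second green
  node becomes a blue cup and the second blue node a blue cap; together with the crossing they
  form a twisted snake on one of the two wires between the remaining nodes.\<close>

lemma green_blue_hopf: "S Green 1 2 1 \<cdot> S Blue 2 1 0 = S Green 1 0 3 \<cdot> S Blue 0 1 0"
proof -
  let ?d = "S Green 1 2 1" and ?b = "S Blue" and ?r = "S Red 0 1 0" and ?I = "idn 1"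
  have cup: "?r \<cdot> ?d = ?b 0 2 0"
    using fusion[of 1 Green 0 0 1 0 2 1] by (simp add: red_unit blue_cup flip: numeral_2_eq_2)
  have "S Green 1 0 3 \<cdot> ?b 0 1 0 = S Green 1 0 3 \<cdot> (?b 0 2 0 \<cdot> (?I \<boxtimes> ?b 1 0 0))"
    using fusion[of 1 Blue 0 1 0 0 0 0] by simp
  also have "\<dots> = (?I \<boxtimes> ?r) \<cdot> (?b 2 1 0 \<cdot> ?d) \<cdot> (?I \<boxtimes> ?b 1 0 0)"
    by (simp add: red_unit_blue_mult flip: cup seq_assoc)
  also have "\<dots> = ((?I \<boxtimes> ?r) \<cdot> (?d \<boxtimes> ?d)) \<cdot> ((?I \<boxtimes> swap 1 1 \<boxtimes> ?I)
      \<cdot> ((?b 2 1 0 \<boxtimes> ?b 2 1 0) \<cdot> (?I \<boxtimes> ?b 1 0 0)))"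
    by (simp only: blue_green_bialgebra[symmetric] seq_assoc)
  also have "(?I \<boxtimes> ?r) \<cdot> (?d \<boxtimes> ?d) = ?d \<boxtimes> ?b 0 2 0"
    by (simp add: interchange cup)
  also have "\<dots> = ?d \<cdot> (?I \<boxtimes> (?I \<boxtimes> ?b 0 2 0))"
    using tens_top_left[of "?b 0 2 0" 0 ?d 2] by (simp flip: tens_assoc)
  also have "(?b 2 1 0 \<boxtimes> ?b 2 1 0) \<cdot> (?I \<boxtimes> ?b 1 0 0) = ?b 2 1 0 \<boxtimes> ?b 2 0 0"
    using fusion[of 1 Blue 2 0 0 0 0 0] by (simp add: interchange)
  also have "\<dots> = (?I \<boxtimes> (?I \<boxtimes> ?b 2 0 0)) \<cdot> ?b 2 1 0"
    using tens_top_right[of "?b 2 1 0" 2 "?b 2 0 0" 0] by (simp flip: tens_assoc)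
  also have "?d \<cdot> (?I \<boxtimes> (?I \<boxtimes> ?b 0 2 0)) \<cdot> ((?I \<boxtimes> swap 1 1 \<boxtimes> ?I) \<cdot> \<dots>)
      = ?d \<cdot> (((?I \<boxtimes> (?I \<boxtimes> ?b 0 2 0)) \<cdot> ((?I \<boxtimes> (swap 1 1 \<boxtimes> ?I)) \<cdot> (?I \<boxtimes> (?I \<boxtimes> ?b 2 0 0))))
        \<cdot> ?b 2 1 0)"
    by (simp only: seq_assoc tens_assoc)
  also have "(?I \<boxtimes> (?I \<boxtimes> ?b 0 2 0)) \<cdot> ((?I \<boxtimes> (swap 1 1 \<boxtimes> ?I)) \<cdot> (?I \<boxtimes> (?I \<boxtimes> ?b 2 0 0)))
      = ?I \<boxtimes> ((?I \<boxtimes> ?b 0 2 0) \<cdot> ((swap 1 1 \<boxtimes> ?I) \<cdot> (?I \<boxtimes> ?b 2 0 0)))"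
    by (simp add: interchange)
  also have "\<dots> = idn 2"
    by (simp add: twisted_snake)
  finally show ?thesis
    by simp
qed

section \<open>The colour-changing gate and supplementarity\<close>

lift_definition cyc :: mor is cgate .

lemma cyc_typed [simp]: "dom cyc = 1" "cod cyc = 1"
  by (transfer, simp add: cgate_def)+

lemma abs_mor_cgate: "abs_mor cgate = cyc" "abs_mor cbar = cyc \<cdot> cyc"
  by (simp_all add: cyc.abs_eq cbar_def seq.abs_eq)

lemma cgate_typed [simp]:
  "inputs cgate = 1" "outputs cgate = 1" "wf_diag cgate"
  "inputs cbar = 1" "outputs cbar = 1" "wf_diag cbar"
  by (simp_all add: cgate_def cbar_def)

lemma cyc_red_green: "cyc = S Red 1 1 1 \<cdot> S Green 1 1 1"
  using rgb_rel_imp_eq[OF rgb_rel.cgate1] by (simp add: abs_mor_simps abs_mor_cgate)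

text \<open>Changing the colour of a blue node without phase, which is a plain wire, gives a green one.\<close>

lemma cyc_cubed: "cyc \<cdot> (cyc \<cdot> cyc) = idn 1"
  using rgb_rel_imp_eq[OF rgb_rel.colour_blue[of 1 1 0]]
  by (simp add: abs_mor_simps abs_mor_cgate seq_assoc)

lemma blue_unit_cyc: "S Blue 0 1 0 \<cdot> cyc = S Green 0 1 0"
  using rgb_rel_imp_eq[OF rgb_rel.colour_blue[of 0 1 0]]
  by (simp add: abs_mor_simps abs_mor_cgate)

lemma cyc_green_mult: "(cyc \<boxtimes> cyc) \<cdot> S Green 2 1 0 = S Blue 2 1 0 \<cdot> cyc"
proof -
  have "S Green 2 1 0 = ((cyc \<cdot> cyc) \<boxtimes> (cyc \<cdot> cyc)) \<cdot> (S Blue 2 1 0 \<cdot> cyc)"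
    using rgb_rel_imp_eq[OF rgb_rel.colour_blue[of 2 1 0]]
    by (simp add: numeral_2_eq_2 abs_mor_simps abs_mor_cgate seq_assoc numeral_2_eq_2)
  then have "(cyc \<boxtimes> cyc) \<cdot> S Green 2 1 0
      = ((cyc \<boxtimes> cyc) \<cdot> ((cyc \<cdot> cyc) \<boxtimes> (cyc \<cdot> cyc))) \<cdot> (S Blue 2 1 0 \<cdot> cyc)"
    by (simp only: seq_assoc)
  also have "(cyc \<boxtimes> cyc) \<cdot> ((cyc \<cdot> cyc) \<boxtimes> (cyc \<cdot> cyc)) = idn 2"
    by (simp add: interchange cyc_cubed)
  finally show ?thesis
    by simp
qed

text \<open>
  The translated rule, with all phases collected: the two copies of \<open>G(3)\<close> from
  \<open>R(1) = c;G(3)\<close> give \<open>G(2)\<close> at the output, and the Hopf law costs \<open>G(3)\<close> twice at the input,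
  once to supply the phase of its comultiplication and once from its counit.
\<close>

lemma supplementarity:
  "S Green 1 2 0 \<cdot> (S Red 1 1 1 \<boxtimes> S Red 1 1 1) \<cdot> S Green 2 1 0 = S Green 1 0 2 \<cdot> S Green 0 1 2"
proof -
  let ?g = "S Green" and ?b = "S Blue"
  have red: "S Red 1 1 1 = cyc \<cdot> ?g 1 1 3"
    using fusion[of 1 Green 1 0 1 0 1 3] by (simp add: phase_arith cyc_red_green seq_assoc)
  have "(?g 1 1 3 \<boxtimes> ?g 1 1 3) \<cdot> ?g 2 1 0
      = (idn 1 \<boxtimes> ?g 1 1 3) \<cdot> ((?g 1 1 3 \<boxtimes> idn 1) \<cdot> ?g 2 1 0)"
    using tens_top_right[of "?g 1 1 3" 1 "?g 1 1 3" 1] by (simp flip: seq_assoc)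
  also have "(?g 1 1 3 \<boxtimes> idn 1) \<cdot> ?g 2 1 0 = ?g 2 1 3"
    using fusion[of 1 Green 1 0 3 1 1 0] by simp
  also have "(idn 1 \<boxtimes> ?g 1 1 3) \<cdot> ?g 2 1 3 = ?g 2 1 2"
    using cofusion[of 1 1 Green 1 0 3 1 3] by (simp add: phase_arith)
  also have "\<dots> = ?g 2 1 0 \<cdot> ?g 1 1 2"
    using fusion[of 1 Green 2 0 0 0 1 2] by simp
  finally have phases: "(?g 1 1 3 \<boxtimes> ?g 1 1 3) \<cdot> ?g 2 1 0 = ?g 2 1 0 \<cdot> ?g 1 1 2" .
  have comult: "?g 1 2 0 = ?g 1 1 3 \<cdot> ?g 1 2 1"
    using fusion[of 1 Green 1 0 3 0 2 1] by (simp add: phase_arith numeral_2_eq_2)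
  have "?g 1 2 0 \<cdot> (S Red 1 1 1 \<boxtimes> S Red 1 1 1) \<cdot> ?g 2 1 0
      = ?g 1 2 0 \<cdot> ((cyc \<boxtimes> cyc) \<cdot> ((?g 1 1 3 \<boxtimes> ?g 1 1 3) \<cdot> ?g 2 1 0))"
    by (simp add: red interchange flip: seq_assoc)
  also have "\<dots> = ?g 1 2 0 \<cdot> (?b 2 1 0 \<cdot> cyc \<cdot> ?g 1 1 2)"
    by (simp add: phases cyc_green_mult flip: seq_assoc)
  also have "\<dots> = ?g 1 1 3 \<cdot> (?g 1 2 1 \<cdot> ?b 2 1 0) \<cdot> (cyc \<cdot> ?g 1 1 2)"
    by (simp only: comult seq_assoc)
  also have "\<dots> = (?g 1 1 3 \<cdot> ?g 1 0 3) \<cdot> ((?b 0 1 0 \<cdot> cyc) \<cdot> ?g 1 1 2)"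
    by (simp only: green_blue_hopf seq_assoc)
  also have "?g 1 1 3 \<cdot> ?g 1 0 3 = ?g 1 0 2"
    using fusion[of 1 Green 1 0 3 0 0 3] by (simp add: phase_arith)
  also have "(?b 0 1 0 \<cdot> cyc) \<cdot> ?g 1 1 2 = ?g 0 1 2"
    using fusion[of 1 Green 0 0 0 0 1 2] by (simp add: blue_unit_cyc)
  finally show ?thesis .
qed

lemma abs_mor_eqD: "f \<in> hom m n \<Longrightarrow> abs_mor f = abs_mor g \<Longrightarrow> rgb_eq m n f g"
  by (simp add: mor.abs_eq_iff same_morphism_imp_diag_eq)

theorem proposition5p3:
  shows "rgb_eq 1 1
    (translate (rg_spider green 1 2 0 ;; (rg_spider red 1 1 1 \<otimes> rg_spider red 1 1 1)
      ;; rg_spider green 2 1 0))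
    (translate (rg_spider green 1 0 2 ;; rg_spider green 0 1 2))"
proof -
  have "rgb_eq 1 1
    (spider Green 1 2 0 ;; (spider Red 1 1 1 \<otimes> spider Red 1 1 1) ;; spider Green 2 1 0)
    (spider Green 1 0 2 ;; spider Green 0 1 2)"
    by (rule abs_mor_eqD) (simp_all add: hom_def abs_mor_simps supplementarity)
  (* Green nodes and red phase gates translate to the same diagrams in the other alphabet; only
     red nodes of other arities acquire phases. *)
  then show ?thesis
    by (simp add: spider_def numeral_2_eq_2)
qed

end
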